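(* Every semisimple subvariety of the variety $\mathbf{I}$ of implication zroupoids is locally finite.
   Context: An implication zroupoid is an algebra $\mathbf{A} = \langle A, \to, 0\rangle$, with $\to$ binary and $0$ a constant, satisfying, with the abbreviation $x' := x \to 0$ (so $x'' = (x\to 0)\to 0$), the identities (I) $(x \to y) \to z \approx [(z' \to x) \to (y \to z)']'$ and (I$_0$) $0'' \approx 0$. The variety of all implication zroupoids is denoted $\mathbf{I}$. An algebra is simple if it has more than one element and its only congruences are the identity relation $\Delta$ and $A \times A$. A variety is semisimple if and only if every (nontrivial) subdirectly irreducible algebra in it is simple. A variety is locally finite if each of its finitely generated members is finite. *)

theory Defs
  imports Main "HOL-Library.FuncSet"
begin

record 'a zroupoid =
  carrier :: "'a set"
  imp :: "'a \<Rightarrow> 'a \<Rightarrow> 'a"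
  zero :: 'a

definition zroupoid :: "'a zroupoid \<Rightarrow> bool" where
  "zroupoid A \<longleftrightarrow>
     zero A \<in> carrier A \<and> (\<forall>x\<in>carrier A. \<forall>y\<in>carrier A. imp A x y \<in> carrier A)"

definition neg :: "'a zroupoid \<Rightarrow> 'a \<Rightarrow> 'a" where
  "neg A x = imp A x (zero A)"

definition implication_zroupoids :: "'a zroupoid set" where
  "implication_zroupoids = {A. zroupoid A \<and>
     (\<forall>x\<in>carrier A. \<forall>y\<in>carrier A. \<forall>z\<in>carrier A.
        imp A (imp A x y) z =
        neg A (imp A (imp A (neg A z) x) (neg A (imp A y z)))) \<and>
     neg A (neg A (zero A)) = zero A}"


subsection \<open>Varieties\<close>

datatype zterm = Var nat | Zero | Imp zterm zterm

fun eval :: "'a zroupoid \<Rightarrow> (nat \<Rightarrow> 'a) \<Rightarrow> zterm \<Rightarrow> 'a" where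
  "eval A v (Var n) = v n"
| "eval A v Zero = zero A"
| "eval A v (Imp s t) = imp A (eval A v s) (eval A v t)"

definition models :: "(zterm \<times> zterm) set \<Rightarrow> 'a zroupoid set" where
  "models E = {A. zroupoid A \<and>
     (\<forall>(s, t)\<in>E. \<forall>v. range v \<subseteq> carrier A \<longrightarrow> eval A v s = eval A v t)}"

text \<open>
  A class of algebras is represented by its members whose universe is a subset of the
  ambient type \<open>'a\<close>; \<open>'a\<close> is arbitrary. Varieties are equational classes.
\<close>

definition variety :: "'a zroupoid set \<Rightarrow> bool" where
  "variety V \<longleftrightarrow> (\<exists>E. V = models E)"

definition subvariety :: "'a zroupoid set \<Rightarrow> 'a zroupoid set \<Rightarrow> bool" where
  "subvariety V W \<longleftrightarrow> variety V \<and> V \<subseteq> W"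

lemma variety_implication_zroupoids: "variety implication_zroupoids"
proof -
  let ?x = "Var 0" and ?y = "Var 1" and ?z = "Var 2"
  let ?n = "\<lambda>t. Imp t Zero"
  let ?E = "{(Imp (Imp ?x ?y) ?z, ?n (Imp (Imp (?n ?z) ?x) (?n (Imp ?y ?z)))),
             (?n (?n Zero), Zero)}"
  have "A \<in> models ?E \<longleftrightarrow> A \<in> implication_zroupoids" for A :: "'a zroupoid"
  proof
    assume A: "A \<in> models ?E"
    have z: "zero A \<in> carrier A"
      using A by (auto simp: models_def zroupoid_def)
    have "imp A (imp A x y) z = neg A (imp A (imp A (neg A z) x) (neg A (imp A y z)))"
      if "x \<in> carrier A" "y \<in> carrier A" "z \<in> carrier A" for x y z
    proof -
      let ?v = "\<lambda>n::nat. if n = 0 then x else if n = 1 then y else z"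
      have "range ?v \<subseteq> carrier A" using that by auto
      with A have "eval A ?v (Imp (Imp ?x ?y) ?z) =
          eval A ?v (?n (Imp (Imp (?n ?z) ?x) (?n (Imp ?y ?z))))"
        unfolding models_def by blast
      then show ?thesis by (simp add: neg_def)
    qed
    moreover have "neg A (neg A (zero A)) = zero A"
    proof -
      have "range (\<lambda>_::nat. zero A) \<subseteq> carrier A" using z by auto
      with A have "eval A (\<lambda>_. zero A) (?n (?n Zero)) = eval A (\<lambda>_. zero A) Zero"
        unfolding models_def by blast
      then show ?thesis by (simp add: neg_def)
    qed
    ultimately show "A \<in> implication_zroupoids"
      using A by (auto simp: models_def implication_zroupoids_def)
  next
    assume "A \<in> implication_zroupoids"
    then show "A \<in> models ?E"
      by (auto simp: models_def implication_zroupoids_def neg_def image_subset_iff)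
  qed
  then show ?thesis unfolding variety_def by blast
qed


subsection \<open>Simple and subdirectly irreducible algebras\<close>

definition nontrivial :: "'a zroupoid \<Rightarrow> bool" where
  "nontrivial A \<longleftrightarrow> (\<exists>x\<in>carrier A. \<exists>y\<in>carrier A. x \<noteq> y)"

definition congruence :: "'a zroupoid \<Rightarrow> ('a \<times> 'a) set \<Rightarrow> bool" where
  "congruence A \<theta> \<longleftrightarrow> equiv (carrier A) \<theta> \<and>
     (\<forall>(x, y)\<in>\<theta>. \<forall>(u, w)\<in>\<theta>. (imp A x u, imp A y w) \<in> \<theta>)"

definition simple :: "'a zroupoid \<Rightarrow> bool" where
  "simple A \<longleftrightarrow> nontrivial A \<and>
     (\<forall>\<theta>. congruence A \<theta> \<longrightarrow> \<theta> = Id_on (carrier A) \<or> \<theta> = carrier A \<times> carrier A)"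

definition homs :: "'a zroupoid \<Rightarrow> 'b zroupoid \<Rightarrow> ('a \<Rightarrow> 'b) set" where
  "homs A B = {h \<in> carrier A \<rightarrow> carrier B. h (zero A) = zero B \<and>
     (\<forall>x\<in>carrier A. \<forall>y\<in>carrier A. h (imp A x y) = imp B (h x) (h y))}"

definition product :: "'i set \<Rightarrow> ('i \<Rightarrow> 'b zroupoid) \<Rightarrow> ('i \<Rightarrow> 'b) zroupoid" where
  "product I B =
     \<lparr> carrier = (\<Pi>\<^sub>E i\<in>I. carrier (B i)),
       imp = (\<lambda>f g. \<lambda>i\<in>I. imp (B i) (f i) (g i)),
       zero = (\<lambda>i\<in>I. zero (B i)) \<rparr>"

definition subdirect_embedding ::
  "'a zroupoid \<Rightarrow> 'i set \<Rightarrow> ('i \<Rightarrow> 'b zroupoid) \<Rightarrow> ('a \<Rightarrow> 'i \<Rightarrow> 'b) \<Rightarrow> bool" where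
  "subdirect_embedding A I B h \<longleftrightarrow>
     h \<in> homs A (product I B) \<and> inj_on h (carrier A) \<and>
     (\<forall>i\<in>I. (\<lambda>x. h x i) ` carrier A = carrier (B i))"

text \<open>
  The choice of types for the factors and for the index set loses no generality: each
  factor is a homomorphic image of \<open>A\<close>, hence isomorphic to an algebra on a set of
  representatives in \<open>carrier A\<close>, and factors with the same kernel may be merged, so that
  the congruences of \<open>A\<close> suffice as indices.
\<close>

definition subdirectly_irreducible :: "'a zroupoid \<Rightarrow> bool" where
  "subdirectly_irreducible A \<longleftrightarrow>
     (\<forall>(I :: ('a \<times> 'a) set set) (B :: ('a \<times> 'a) set \<Rightarrow> 'a zroupoid) h.
        (\<forall>i\<in>I. zroupoid (B i)) \<and> subdirect_embedding A I B h \<longrightarrow>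
        (\<exists>i\<in>I. bij_betw (\<lambda>x. h x i) (carrier A) (carrier (B i))))"

definition semisimple :: "'a zroupoid set \<Rightarrow> bool" where
  "semisimple V \<longleftrightarrow>
     (\<forall>A\<in>V. nontrivial A \<and> subdirectly_irreducible A \<longrightarrow> simple A)"


subsection \<open>Local finiteness\<close>

inductive_set generated :: "'a zroupoid \<Rightarrow> 'a set \<Rightarrow> 'a set" for A G where
  base: "x \<in> G \<Longrightarrow> x \<in> generated A G"
| zero: "zero A \<in> generated A G"
| imp: "x \<in> generated A G \<Longrightarrow> y \<in> generated A G \<Longrightarrow> imp A x y \<in> generated A G"

definition finitely_generated :: "'a zroupoid \<Rightarrow> bool" where
  "finitely_generated A \<longleftrightarrow>
     (\<exists>G. finite G \<and> G \<subseteq> carrier A \<and> generated A G = carrier A)"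

definition locally_finite :: "'a zroupoid set \<Rightarrow> bool" where
  "locally_finite V \<longleftrightarrow> (\<forall>A\<in>V. finitely_generated A \<longrightarrow> finite (carrier A))"

end

theory Submission
  imports Defs
begin

text \<open>
  A finitely generated algebra \<open>A\<close> of a semisimple variety \<open>V\<close> is a subdirect
  product of simple algebras of \<open>V\<close>: by Zorn's lemma any two distinct elements are separated
  by a congruence maximal among those that separate them, the quotient is subdirectly irreducible and
  lies in \<open>V\<close>, so it is simple. The heart of the matter is that a simple implication
  zroupoid has at most four elements (\<open>simple_card_le_4\<close>). Granted this, \<open>A\<close>
  has, up to renaming of values, only finitely many homomorphisms onto the separating quotients, because
  such a map is determined by the operation table of its image and by its values on the generators; the
  finitely many maps separate points, so \<open>A\<close> is finite (\<open>finite_if_separated\<close>).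

  The bound four comes from playing congruences of a simple algebra off against each other, each of them
  the kernel of an explicit map, which must therefore be injective or constant.

  \<^item> Collapsing the set of all products \<open>x \<rightarrow> y\<close> to a point gives a
    congruence. Hence either all products are \<open>0\<close>, and any two-block partition is a
    congruence, or every element is a product. In the second case the defining identity makes every
    element a complement, so a double complement, and then \<open>x'''' = x''\<close> yields \<open>x'' =
    x\<close> throughout.
  \<^item> When \<open>x'' = x\<close>, the idempotent map \<open>x \<mapsto> 0 \<rightarrow> x\<close>
    has a congruence as kernel (\<open>zero_imp_cong\<close>). If it is injective then \<open>0
    \<rightarrow> x = x\<close>, and a product is \<open>0\<close> only if both factors are; so
    \<open>{0}\<close> and its complement are the blocks of a congruence, and there are just two
    elements.
  \<^item> If it is constant then the algebra is a De Morgan algebra with \<open>x \<rightarrow> y = x'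
    \<or> y\<close>. For every element \<open>a\<close> the map \<open>x \<mapsto> (a' \<or> x, a' \<or>
    x')\<close> has a congruence as kernel, so it is injective for \<open>a \<noteq> 0\<close>. This
    forces every element other than \<open>0\<close> and \<open>1\<close> to equal its complement, and
    leaves room for at most two such elements.
\<close>


section \<open>Consequences of the defining identities\<close>

text \<open>
  The identities are derived for an operation on the whole type, so that the equational reasoning is free
  of membership conditions. An algebra whose universe is a proper subset of the type is brought into this
  form by composing its operation with a retraction onto the universe. Identities survive this, except
  possibly those with a bare variable as one side; that is why \<open>x'' = x\<close> is replaced below
  by its three instances under or around an operation symbol.
\<close>

locale total_zroupoid =
  fixes imp :: "'a \<Rightarrow> 'a \<Rightarrow> 'a" (infixr "\<leadsto>" 65) and zero :: 'a ("\<zero>")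
  assumes I: "(x \<leadsto> y) \<leadsto> w = (((w \<leadsto> \<zero>) \<leadsto> x) \<leadsto> ((y \<leadsto> w) \<leadsto> \<zero>)) \<leadsto> \<zero>"
    and I0: "(\<zero> \<leadsto> \<zero>) \<leadsto> \<zero> = \<zero>"
begin

abbreviation cmp :: "'a \<Rightarrow> 'a" ("\<sim>_" [80] 80) where "\<sim>x \<equiv> x \<leadsto> \<zero>"

text \<open>
  In several positions, \<open>\<sim>\<zero>\<close> can be deleted as if it were a left unit of the
  operation. One of them makes the defining identity for \<open>(x \<leadsto> y) \<leadsto>
  \<zero>\<close> yield \<open>\<sim>(x \<leadsto> \<sim>\<sim>y) = \<sim>(x \<leadsto> y)\<close>, and
  with \<open>x = \<sim>\<zero>\<close> this deletes two of the four complements.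
\<close>

lemma four_neg: "\<sim>\<sim>\<sim>\<sim>x = \<sim>\<sim>x"
proof -
  have a: "\<sim>\<sim>(\<sim>\<zero> \<leadsto> x) = \<sim>\<sim>x" for x
    using I[of x \<zero> \<zero>] I[of \<zero> \<zero> x] I0 by metis
  have b: "\<sim>(x \<leadsto> \<sim>\<zero> \<leadsto> y) = \<sim>(x \<leadsto> y)" for x y
    by (metis I a)
  have c: "(\<zero> \<leadsto> x) \<leadsto> \<sim>\<zero> \<leadsto> y = (\<zero> \<leadsto> x) \<leadsto> y" for x y
    by (metis I a b)
  have d: "\<sim>((\<sim>\<zero> \<leadsto> x) \<leadsto> y) = \<sim>(x \<leadsto> y)" for x y
    by (metis I I0 c)
  have e: "\<sim>(x \<leadsto> \<sim>\<sim>y) = \<sim>(x \<leadsto> y)" for x y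
    by (metis I d)
  show ?thesis by (metis a e)
qed

end

locale involutive_zroupoid = total_zroupoid +
  assumes neg_neg_left: "\<sim>\<sim>x \<leadsto> y = x \<leadsto> y"
    and neg_neg_right: "x \<leadsto> \<sim>\<sim>y = x \<leadsto> y"
    and neg_neg_imp: "\<sim>\<sim>(x \<leadsto> y) = x \<leadsto> y"
begin

lemmas nn = neg_neg_left neg_neg_right neg_neg_imp

lemma one_imp: "\<sim>\<zero> \<leadsto> x = \<sim>\<sim>x"
  by (metis I I0 nn)

lemma neg_imp_self: "\<sim>x \<leadsto> x = \<sim>\<sim>x"
  by (metis I nn one_imp)

lemma self_imp_neg: "x \<leadsto> \<sim>x = \<sim>x"
  by (metis neg_imp_self nn)

text \<open>
  Only \<open>\<zero> \<leadsto> y\<close>, and not \<open>y\<close> itself, matters in \<open>(x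
  \<leadsto> y) \<leadsto> x\<close>. In the two extreme cases \<open>\<zero> \<leadsto> y =
  \<sim>\<zero>\<close> and \<open>\<zero> \<leadsto> y = \<sim>\<sim>y\<close> this becomes the
  absorption law of De Morgan algebras and a semilattice law, respectively.
\<close>

lemma imp_imp_self: "(x \<leadsto> y) \<leadsto> x = (\<zero> \<leadsto> y) \<leadsto> x"
  by (metis I nn self_imp_neg)

lemma imp_one: "x \<leadsto> \<sim>\<zero> = \<zero> \<leadsto> \<sim>x"
  by (metis I I0 nn one_imp imp_imp_self self_imp_neg neg_imp_self)

lemma zero_imp_zero_imp: "\<zero> \<leadsto> \<zero> \<leadsto> x = \<zero> \<leadsto> x"
  by (metis I I0 nn one_imp imp_imp_self imp_one self_imp_neg neg_imp_self)

text \<open>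
  The next lemmas show that \<open>\<zero> \<leadsto> x \<leadsto> y\<close> depends only on
  \<open>\<zero> \<leadsto> x\<close> and \<open>\<zero> \<leadsto> y\<close>. The route is to prove it
  for \<open>(x \<leadsto> y) \<leadsto> \<zero> \<leadsto> w\<close> first, where the defining identity
  applies, and to pass to \<open>\<zero> \<leadsto> x \<leadsto> y\<close> by two multiplications with
  \<open>\<sim>\<zero> = \<zero> \<leadsto> \<zero>\<close> on the right.
\<close>

lemma zero_imp_left: "(\<zero> \<leadsto> x) \<leadsto> (\<zero> \<leadsto> y) = x \<leadsto> (\<zero> \<leadsto> y)"
  by (metis I I0 nn one_imp imp_imp_self imp_one self_imp_neg neg_imp_self)

lemma imp_one_one: "(x \<leadsto> \<sim>\<zero>) \<leadsto> \<sim>\<zero> = \<zero> \<leadsto> x"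
  using imp_imp_self[of "\<sim>\<zero>" "\<sim>x"] by (simp add: imp_one one_imp nn)

lemma zero_imp_middle: "(x \<leadsto> \<zero> \<leadsto> y) \<leadsto> \<zero> \<leadsto> w = (x \<leadsto> y) \<leadsto> \<zero> \<leadsto> w"
  using I[of x "\<zero> \<leadsto> y" "\<zero> \<leadsto> w"] I[of x y "\<zero> \<leadsto> w"] by (simp only: zero_imp_left)

lemma zero_imp_imp_right: "\<zero> \<leadsto> x \<leadsto> \<zero> \<leadsto> y = \<zero> \<leadsto> x \<leadsto> y"
  using zero_imp_middle[of x y \<zero>] imp_one_one by metis

lemma zero_imp_imp_left: "\<zero> \<leadsto> (\<zero> \<leadsto> x) \<leadsto> y = \<zero> \<leadsto> x \<leadsto> y"
  using zero_imp_imp_right[of "\<zero> \<leadsto> x" y] zero_imp_imp_right[of x y] by (simp only: zero_imp_left)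

lemma zero_imp_cong:
  assumes "\<zero> \<leadsto> x = \<zero> \<leadsto> y" "\<zero> \<leadsto> u = \<zero> \<leadsto> w"
  shows "\<zero> \<leadsto> x \<leadsto> u = \<zero> \<leadsto> y \<leadsto> w"
proof -
  have "\<zero> \<leadsto> x \<leadsto> u = \<zero> \<leadsto> (\<zero> \<leadsto> x) \<leadsto> \<zero> \<leadsto> u" for x u
    by (simp only: zero_imp_imp_left zero_imp_imp_right)
  then show ?thesis using assms by metis
qed

text \<open>
  With \<open>\<zero> \<leadsto> v = \<sim>\<sim>v\<close> the operation resembles \<open>\<sim>x \<and>
  y\<close> in a semilattice with greatest element \<open>\<zero>\<close> and an order automorphism
  \<open>\<sim>\<close>: a meet is the greatest element only if both its arguments are. The proof
  computes \<open>(y \<leadsto> x) \<leadsto> y\<close> in two ways.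
\<close>

lemma imp_eq_zero:
  assumes zero_imp: "\<And>v. \<zero> \<leadsto> v = \<sim>\<sim>v" and xy: "x \<leadsto> y = \<zero>"
  shows "\<sim>\<sim>x = \<zero>" "\<sim>\<sim>y = \<zero>"
proof -
  have one: "\<sim>\<zero> = \<zero>"
    using zero_imp[of \<zero>] I0 by simp
  have "(y \<leadsto> x) \<leadsto> y = \<sim>y \<leadsto> y"
    using I[of y x y] xy nn one by metis
  moreover have "(y \<leadsto> x) \<leadsto> y = \<zero>"
    using imp_imp_self zero_imp xy nn by metis
  ultimately show y: "\<sim>\<sim>y = \<zero>"
    using neg_imp_self by metis
  then show "\<sim>\<sim>x = \<zero>"
    using xy nn one by metis
qed

end


section \<open>De Morgan algebras\<close>

text \<open>
  If \<open>\<zero> \<leadsto> x\<close> is constant, then \<open>x \<leadsto> y\<close> is the join of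
  \<open>\<sim>x\<close> and \<open>y\<close> in a De Morgan algebra with least element
  \<open>\<zero>\<close> and greatest element \<open>\<sim>\<zero>\<close>.
\<close>

locale de_morgan_zroupoid = involutive_zroupoid +
  assumes zero_imp: "\<zero> \<leadsto> x = \<sim>\<zero>"
begin

lemma imp_true: "x \<leadsto> \<sim>\<zero> = \<sim>\<zero>"
  by (metis imp_one zero_imp)

lemma absorb: "(x \<leadsto> y) \<leadsto> x = \<sim>\<sim>x"
  by (metis imp_imp_self zero_imp one_imp)

lemma neg_imp_commute: "\<sim>x \<leadsto> y = \<sim>y \<leadsto> x"
  using I[of x \<zero> y] zero_imp I0 nn by metis

lemma contrapos: "x \<leadsto> \<sim>y = y \<leadsto> \<sim>x"
  by (metis neg_imp_commute nn)

text \<open>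
  The defining identity is the distributive law \<open>(x \<and> \<sim>u) \<or> w = (w \<or> x) \<and>
  (\<sim>u \<or> w)\<close>; contraposition moves \<open>w = \<sim>a\<close> to the left.
\<close>

lemma imp_distrib: "a \<leadsto> \<sim>(x \<leadsto> u) = \<sim>((a \<leadsto> x) \<leadsto> \<sim>(a \<leadsto> \<sim>u))"
  using I[of x u "\<sim>a"] by (simp only: contrapos[of a "x \<leadsto> u"] contrapos[of a u] nn)

definition join where "join x y = \<sim>x \<leadsto> y"
definition meet where "meet x y = \<sim>(x \<leadsto> \<sim>y)"

lemma neg_neg_join: "join (\<sim>\<sim>x) y = join x y" "join x (\<sim>\<sim>y) = join x y"
  by (simp_all add: join_def nn)

lemma join_commute: "join x y = join y x"
  unfolding join_def by (rule neg_imp_commute)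

lemma meet_commute: "meet x y = meet y x"
  unfolding meet_def by (simp only: contrapos[of x y])

lemma meet_join_distrib: "meet a (join x y) = join (meet a x) (meet a y)"
  unfolding join_def meet_def using imp_distrib[of a "\<sim>x" y] by (simp add: nn)

lemma meet_join_absorb: "meet x (join x y) = \<sim>\<sim>x"
  unfolding join_def meet_def using contrapos[of x "\<sim>x \<leadsto> y"] absorb[of "\<sim>x" y] by (simp add: nn)

lemma join_meet_absorb: "join x (meet x y) = \<sim>\<sim>x"
  unfolding join_def meet_def using contrapos[of "\<sim>x" "x \<leadsto> \<sim>y"] absorb[of x "\<sim>y"] by (simp add: nn)

lemma join_idem: "join x x = \<sim>\<sim>x"
  unfolding join_def by (rule neg_imp_self)

lemma meet_join_middle: "meet t (join s (join t u)) = \<sim>\<sim>t"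
proof -
  have "meet t (join s (join t u)) = join (\<sim>\<sim>t) (meet t s)"
    by (simp only: meet_join_distrib[of t s] meet_join_absorb join_commute)
  then show ?thesis by (simp only: neg_neg_join join_meet_absorb)
qed

text \<open>
  Associativity follows from distributivity and absorption: each of \<open>x\<close>, \<open>y\<close>,
  \<open>z\<close> is returned by a meet with either side. So the meet of the two sides, expanded along
  the joins of one of them, is that side; expanding along the other shows that the sides are equal.
\<close>

lemma join_assoc: "join (join x y) z = join x (join y z)" (is "?L = ?R")
proof -
  have R: "meet ?R x = \<sim>\<sim>x" "meet ?R y = \<sim>\<sim>y" "meet ?R z = \<sim>\<sim>z"
    using meet_join_absorb[of x "join y z"] meet_join_middle[of y x z] meet_join_middle[of z x y]
    by (simp_all only: meet_commute[of ?R] join_commute[of z y])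
  have L: "meet ?L x = \<sim>\<sim>x" "meet ?L y = \<sim>\<sim>y" "meet ?L z = \<sim>\<sim>z"
    using meet_join_absorb[of z "join x y"] meet_join_middle[of x z y] meet_join_middle[of y z x]
    by (simp_all only: meet_commute[of ?L] join_commute[of z "join x y"] join_commute[of y x])
  have "?L = meet ?R ?L"
    by (simp only: meet_join_distrib[of ?R] R neg_neg_join)
  also have "\<dots> = meet ?L ?R"
    by (rule meet_commute)
  also have "\<dots> = ?R"
    by (simp only: meet_join_distrib[of ?L] L neg_neg_join)
  finally show ?thesis .
qed

lemma join_join_distrib: "join a (join x u) = join (join a x) (join a u)"
proof -
  have "join (join a x) (join a u) = join a (join (join x a) u)"
    by (simp only: join_assoc)
  also have "\<dots> = join (join a a) (join x u)"
    by (simp only: join_commute[of x a] join_assoc)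
  finally show ?thesis by (simp only: join_idem neg_neg_join)
qed

lemma imp_imp_distrib: "a \<leadsto> x \<leadsto> u = \<sim>(a \<leadsto> \<sim>x) \<leadsto> a \<leadsto> u"
  using join_join_distrib[of "\<sim>a" "\<sim>x" u] by (simp add: join_def nn)

text \<open>
  For fixed \<open>a\<close>, the kernel of \<open>x \<mapsto> (a \<leadsto> x, a \<leadsto>
  \<sim>x)\<close> is a congruence, because a join is distributive over joins and over meets. It
  identifies \<open>x\<close> and \<open>y\<close> exactly when they have the same join with
  \<open>\<sim>a\<close> and the same meet with \<open>a\<close>.
\<close>

lemma imp_cong_pair:
  assumes "a \<leadsto> x = a \<leadsto> y" "a \<leadsto> \<sim>x = a \<leadsto> \<sim>y"
    and "a \<leadsto> u = a \<leadsto> w" "a \<leadsto> \<sim>u = a \<leadsto> \<sim>w"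
  shows "a \<leadsto> x \<leadsto> u = a \<leadsto> y \<leadsto> w" "a \<leadsto> \<sim>(x \<leadsto> u) = a \<leadsto> \<sim>(y \<leadsto> w)"
proof -
  show "a \<leadsto> x \<leadsto> u = a \<leadsto> y \<leadsto> w"
    unfolding imp_imp_distrib[of a x u] imp_imp_distrib[of a y w] assms ..
  show "a \<leadsto> \<sim>(x \<leadsto> u) = a \<leadsto> \<sim>(y \<leadsto> w)"
    unfolding imp_distrib[of a x u] imp_distrib[of a y w] assms ..
qed

lemma neg_imp_self_imp: "\<sim>(a \<leadsto> a) \<leadsto> a = a \<leadsto> a" "\<sim>(a \<leadsto> a) \<leadsto> \<sim>a = a \<leadsto> a"
proof -
  have "join (join (\<sim>a) a) a = join (\<sim>a) a"
    by (simp only: join_assoc join_idem neg_neg_join)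
  then show "\<sim>(a \<leadsto> a) \<leadsto> a = a \<leadsto> a"
    by (simp only: join_def nn)
  have "join (join (\<sim>a) a) (\<sim>a) = join (\<sim>a) a"
    by (simp only: join_commute[of "join (\<sim>a) a"] join_assoc[symmetric] join_idem neg_neg_join)
  then show "\<sim>(a \<leadsto> a) \<leadsto> \<sim>a = a \<leadsto> a"
    by (simp only: join_def nn)
qed

lemma imp_imp_same: "a \<leadsto> a \<leadsto> b = a \<leadsto> b"
proof -
  have "join (\<sim>a) (join (\<sim>a) b) = join (\<sim>a) b"
    by (simp only: join_assoc[symmetric] join_idem neg_neg_join)
  then show ?thesis by (simp only: join_def nn)
qed

lemma neg_join_zero:
  assumes "a \<leadsto> b = \<zero>" shows "\<sim>a = \<zero>"
proof -
  have "\<sim>\<sim>a = \<sim>\<zero>"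
    using absorb[of a b] zero_imp[of a] unfolding assms by (rule trans[OF sym])
  then show ?thesis using nn(3)[of a \<zero>] I0 by metis
qed

text \<open>
  If the join of two self-complementary elements is again self-complementary, it equals their meet, so
  the two elements coincide.
\<close>

lemma fixed_join_eq:
  assumes "\<sim>a = a" "\<sim>b = b" "\<sim>(a \<leadsto> b) = a \<leadsto> b"
  shows "a = b"
proof -
  have eq: "a \<leadsto> b = a" if a: "\<sim>a = a" and d: "\<sim>(a \<leadsto> b) = a \<leadsto> b" for a b
  proof -
    have "a \<leadsto> b = a \<leadsto> \<sim>(a \<leadsto> b)"
      by (simp only: d imp_imp_same)
    also have "\<dots> = (a \<leadsto> b) \<leadsto> \<sim>a"
      by (rule contrapos)
    also have "\<dots> = a"
      by (simp only: a absorb)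
    finally show ?thesis .
  qed
  have "a \<leadsto> b = b \<leadsto> a"
    using contrapos[of a b] unfolding assms .
  then show ?thesis using eq[of a b] eq[of b a] assms by metis
qed

end


section \<open>Simple implication zroupoids\<close>

lemma implication_zroupoidD:
  assumes "A \<in> implication_zroupoids"
  shows "zroupoid A"
    and "neg A (neg A (zero A)) = zero A"
    and "\<lbrakk>x \<in> carrier A; y \<in> carrier A; w \<in> carrier A\<rbrakk> \<Longrightarrow>
      imp A (imp A x y) w = neg A (imp A (imp A (neg A w) x) (neg A (imp A y w)))"
  using assms unfolding implication_zroupoids_def by blast+

lemma zroupoidD:
  assumes "zroupoid A"
  shows "zero A \<in> carrier A"
    and "\<lbrakk>x \<in> carrier A; y \<in> carrier A\<rbrakk> \<Longrightarrow> imp A x y \<in> carrier A"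
    and "x \<in> carrier A \<Longrightarrow> neg A x \<in> carrier A"
  using assms by (simp_all add: zroupoid_def neg_def)

text \<open>
  The kernel of a compatible map is a congruence. Every congruence to which simplicity is applied arises
  in this way, and simplicity then says that the map is injective or constant.
\<close>

definition compatible :: "'a zroupoid \<Rightarrow> ('a \<Rightarrow> 'b) \<Rightarrow> bool" where
  "compatible A f \<longleftrightarrow> (\<forall>x\<in>carrier A. \<forall>y\<in>carrier A. \<forall>u\<in>carrier A. \<forall>w\<in>carrier A.
     f x = f y \<longrightarrow> f u = f w \<longrightarrow> f (imp A x u) = f (imp A y w))"

lemma compatibleI:
  "(\<And>x y u w. \<lbrakk>x \<in> carrier A; y \<in> carrier A; u \<in> carrier A; w \<in> carrier A; f x = f y; f u = f w\<rbrakk>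
    \<Longrightarrow> f (imp A x u) = f (imp A y w)) \<Longrightarrow> compatible A f"
  unfolding compatible_def by blast

lemma compatibleD:
  "\<lbrakk>compatible A f; f x = f y; f u = f w;
    x \<in> carrier A; y \<in> carrier A; u \<in> carrier A; w \<in> carrier A\<rbrakk> \<Longrightarrow> f (imp A x u) = f (imp A y w)"
  unfolding compatible_def by blast

lemma congruence_kernel:
  assumes "zroupoid A" "compatible A f"
  shows "congruence A {(x, y). x \<in> carrier A \<and> y \<in> carrier A \<and> f x = f y}"
proof -
  let ?\<theta> = "{(x, y). x \<in> carrier A \<and> y \<in> carrier A \<and> f x = f y}"
  have "equiv (carrier A) ?\<theta>"
    by (auto intro!: equivI simp: refl_on_def sym_def trans_def)
  moreover have "(imp A x u, imp A y w) \<in> ?\<theta>" if "(x, y) \<in> ?\<theta>" "(u, w) \<in> ?\<theta>" for x y u w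
    using that compatibleD[OF assms(2), of x y u w] zroupoidD(2)[OF assms(1)] by simp
  ultimately show ?thesis
    unfolding congruence_def by blast
qed

lemma simple_kernel_cases:
  assumes "simple A" "zroupoid A" "compatible A f"
  obtains "inj_on f (carrier A)" | "\<And>x y. x \<in> carrier A \<Longrightarrow> y \<in> carrier A \<Longrightarrow> f x = f y"
proof -
  define \<theta> where "\<theta> = {(x, y). x \<in> carrier A \<and> y \<in> carrier A \<and> f x = f y}"
  have "congruence A \<theta>"
    unfolding \<theta>_def by (rule congruence_kernel[OF assms(2,3)])
  then consider "\<theta> = Id_on (carrier A)" | "\<theta> = carrier A \<times> carrier A"
    using assms(1) unfolding simple_def by blast
  then show thesis
  proof cases
    case 1
    have "x = y" if "x \<in> carrier A" "y \<in> carrier A" "f x = f y" for x y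
    proof -
      have "(x, y) \<in> \<theta>" using that by (simp add: \<theta>_def)
      then show ?thesis unfolding 1 by blast
    qed
    then show thesis by (intro that(1) inj_onI)
  next
    case 2
    have "f x = f y" if "x \<in> carrier A" "y \<in> carrier A" for x y
    proof -
      have "(x, y) \<in> \<theta>" unfolding 2 using that by blast
      then show ?thesis by (simp add: \<theta>_def)
    qed
    then show thesis by (rule that(2))
  qed
qed

lemma card_le_two_if_inj_bool:
  assumes "inj_on (f :: 'a \<Rightarrow> bool) X" shows "finite X \<and> card X \<le> 2"
  using card_inj_on_le[OF assms, of UNIV] inj_on_finite[OF assms, of UNIV] by simp

lemma simple_indicator:
  assumes A: "simple A" "zroupoid A" and e: "e \<in> carrier A"
    and compat: "compatible A (\<lambda>x. x = e)"
  shows "finite (carrier A) \<and> card (carrier A) \<le> 2"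
proof -
  have "inj_on (\<lambda>x. x = e) (carrier A)"
  proof (rule simple_kernel_cases[OF A compat])
    assume "\<And>x y. x \<in> carrier A \<Longrightarrow> y \<in> carrier A \<Longrightarrow> (x = e) = (y = e)"
    with e A(1) show ?thesis unfolding simple_def nontrivial_def by metis
  qed
  then show ?thesis by (rule card_le_two_if_inj_bool)
qed

lemma simple_null:
  assumes A: "simple A" "zroupoid A"
    and null: "\<And>x y. x \<in> carrier A \<Longrightarrow> y \<in> carrier A \<Longrightarrow> imp A x y = zero A"
  shows "finite (carrier A) \<and> card (carrier A) \<le> 2"
  by (rule simple_indicator[OF A zroupoidD(1)[OF A(2)]]) (simp add: compatible_def null)

text \<open>
  Collapsing all products to \<open>zero A\<close> is compatible with the operation for trivial reasons:
  any product of two elements is collapsed. As soon as there is a product other than \<open>zero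
  A\<close>, the collapse is not injective, so it is constant and every element is a product. That
  \<open>zero A\<close> is itself a product ensures that no element outside the range is sent to
  \<open>zero A\<close>.
\<close>

lemma simple_imp_range:
  assumes A: "simple A" "zroupoid A" and zero: "zero A = imp A a b" "a \<in> carrier A" "b \<in> carrier A"
    and not_null: "\<not> (\<forall>x\<in>carrier A. \<forall>y\<in>carrier A. imp A x y = zero A)"
    and v: "v \<in> carrier A"
  obtains x y where "x \<in> carrier A" "y \<in> carrier A" "v = imp A x y"
proof -
  define J where "J = {imp A x y |x y. x \<in> carrier A \<and> y \<in> carrier A}"
  let ?f = "\<lambda>x. if x \<in> J then zero A else x"
  have J: "imp A x y \<in> J" if "x \<in> carrier A" "y \<in> carrier A" for x y
    using that unfolding J_def by blast
  have JC: "J \<subseteq> carrier A" and zJ: "zero A \<in> J"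
    using A zero unfolding J_def zroupoid_def by auto
  have "v \<in> J"
  proof (rule simple_kernel_cases[OF A, of ?f])
    assume inj: "inj_on ?f (carrier A)"
    have "x = zero A" if "x \<in> J" for x
      using inj_onD[OF inj, of x "zero A"] that JC zJ by auto
    with J not_null show ?thesis by blast
  next
    assume "\<And>x y. x \<in> carrier A \<Longrightarrow> y \<in> carrier A \<Longrightarrow> ?f x = ?f y"
    from this[of v "zero A"] show ?thesis
      using v JC zJ by (auto split: if_splits)
  next
    show "compatible A ?f" using J by (simp add: compatible_def)
  qed
  then show thesis using that unfolding J_def by blast
qed


text \<open>
  The retraction \<open>ret\<close> onto the universe extends the operation of \<open>A\<close> to the
  whole type, which makes the identities of the first section available.
\<close>

locale zroupoid_algebra =
  fixes A :: "'a zroupoid"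
  assumes mem: "A \<in> implication_zroupoids"
begin

definition ret where "ret x = (if x \<in> carrier A then x else zero A)"

definition op where "op x y = imp A (ret x) (ret y)"

lemmas zroupoid = implication_zroupoidD(1)[OF mem]

lemmas zero_mem = zroupoidD(1)[OF zroupoid]
  and imp_mem = zroupoidD(2)[OF zroupoid]
  and neg_mem = zroupoidD(3)[OF zroupoid]

lemma ret_mem: "ret x \<in> carrier A"
  by (simp add: ret_def zero_mem)

lemma ret_id: "x \<in> carrier A \<Longrightarrow> ret x = x"
  by (simp add: ret_def)

lemma op_eq: "x \<in> carrier A \<Longrightarrow> y \<in> carrier A \<Longrightarrow> op x y = imp A x y"
  by (simp add: op_def ret_id)

lemma op_mem: "op x y \<in> carrier A"
  by (simp add: op_def ret_mem imp_mem)

lemma op_zero: "op x (zero A) = neg A (ret x)"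
  by (simp add: op_def ret_id zero_mem neg_def)

sublocale total_zroupoid op "zero A"
proof
  fix x y w
  show "op (op x y) w = op (op (op (op w (zero A)) x) (op (op y w) (zero A))) (zero A)"
    using implication_zroupoidD(3)[OF mem ret_mem ret_mem ret_mem, of x y w]
    by (simp add: op_def ret_id ret_mem imp_mem zero_mem neg_def)
  show "op (op (zero A) (zero A)) (zero A) = zero A"
    using implication_zroupoidD(2)[OF mem] by (simp add: op_zero ret_id zero_mem neg_mem)
qed

lemma four_neg_algebra:
  "x \<in> carrier A \<Longrightarrow> neg A (neg A (neg A (neg A x))) = neg A (neg A x)"
  using four_neg[of x] by (simp add: op_zero ret_id neg_mem)

end

locale involutive_algebra = zroupoid_algebra +
  assumes neg_neg: "x \<in> carrier A \<Longrightarrow> neg A (neg A x) = x"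
begin

lemma op_neg_neg: "op (op x (zero A)) (zero A) = ret x"
  by (simp add: op_zero ret_id ret_mem neg_mem neg_neg)

sublocale involutive_zroupoid op "zero A"
proof
  fix x y
  show "op (op (op x (zero A)) (zero A)) y = op x y" "op x (op (op y (zero A)) (zero A)) = op x y"
    by (simp_all add: op_neg_neg) (simp_all add: op_def ret_id ret_mem)
  show "op (op (op x y) (zero A)) (zero A) = op x y"
    by (simp add: op_neg_neg ret_id op_mem)
qed

text \<open>
  Here a product is \<open>zero A\<close> only if both factors are, so the indicator map of \<open>zero
  A\<close> is compatible.
\<close>

lemma simple_fixed:
  assumes "simple A" and zero_imp: "\<And>x. x \<in> carrier A \<Longrightarrow> imp A (zero A) x = x"
  shows "finite (carrier A) \<and> card (carrier A) \<le> 2"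
proof (rule simple_indicator[OF assms(1) zroupoid zero_mem])
  have zi: "op (zero A) v = op (op v (zero A)) (zero A)" for v
    unfolding op_neg_neg by (simp add: op_def zero_imp ret_mem ret_id zero_mem)
  have "imp A x u = zero A \<longleftrightarrow> x = zero A \<and> u = zero A" if "x \<in> carrier A" "u \<in> carrier A" for x u
  proof
    assume "imp A x u = zero A"
    then have "op x u = zero A" using that by (simp add: op_eq)
    from imp_eq_zero[OF zi this] that show "x = zero A \<and> u = zero A"
      by (simp add: op_neg_neg ret_id)
  qed (simp add: zero_imp zero_mem)
  then show "compatible A (\<lambda>x. x = zero A)"
    by (simp add: compatible_def)
qed

text \<open>
  For \<open>a \<noteq> 0\<close> the pair \<open>(a' \<or> x, a' \<or> x')\<close> determines
  \<open>x\<close> (\<open>separate\<close>), and this is applied three times. With \<open>b = a \<and>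
  a' = (a \<rightarrow> a)'\<close> in place of \<open>a\<close> it does not distinguish \<open>a\<close>
  from \<open>a'\<close>, so \<open>a = a'\<close> unless \<open>b = 0\<close>. If \<open>b = 0\<close>
  and \<open>a \<noteq> 0\<close>, then the pair for \<open>a\<close> does not distinguish
  \<open>a\<close> from \<open>1\<close>. Finally, two distinct self-complementary elements have join
  \<open>1\<close> if the first is not \<open>0\<close>, so if \<open>a\<close>, \<open>b\<close>,
  \<open>c\<close> were three of them, the pair for \<open>a\<close> would not distinguish
  \<open>b\<close> from \<open>c\<close>.
\<close>

lemma simple_de_morgan:
  assumes "simple A" and zero_imp: "\<And>x. x \<in> carrier A \<Longrightarrow> imp A (zero A) x = neg A (zero A)"
  shows "finite (carrier A) \<and> card (carrier A) \<le> 4"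
proof -
  interpret de_morgan_zroupoid op "zero A"
    by unfold_locales (simp add: op_zero, simp add: op_def zero_imp ret_mem ret_id zero_mem)
  let ?C = "carrier A" and ?z = "zero A" and ?i = "op (zero A) (zero A)"
  note id = op_neg_neg ret_id
  have separate: "x = y"
    if "op a x = op a y" "op a (op x ?z) = op a (op y ?z)" "a \<noteq> ?z" "a \<in> ?C" "x \<in> ?C" "y \<in> ?C"
    for a x y
  proof (rule simple_kernel_cases[OF assms(1) zroupoid, of "\<lambda>x. (op a x, op a (op x ?z))"])
    show "compatible A (\<lambda>x. (op a x, op a (op x ?z)))"
    proof (rule compatibleI)
      fix x y u w
      assume "x \<in> ?C" "y \<in> ?C" "u \<in> ?C" "w \<in> ?C"
        "(op a x, op a (op x ?z)) = (op a y, op a (op y ?z))"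
        "(op a u, op a (op u ?z)) = (op a w, op a (op w ?z))"
      then show "(op a (imp A x u), op a (op (imp A x u) ?z)) = (op a (imp A y w), op a (op (imp A y w) ?z))"
        using imp_cong_pair[of a x y u w] by (simp flip: op_eq)
    qed
  next
    assume "inj_on (\<lambda>x. (op a x, op a (op x ?z))) ?C"
    then show ?thesis using that by (auto dest: inj_onD)
  next
    assume "\<And>x y. x \<in> ?C \<Longrightarrow> y \<in> ?C \<Longrightarrow> (op a x, op a (op x ?z)) = (op a y, op a (op y ?z))"
    \<comment> \<open>A constant map gives \<open>0\<close> and \<open>1\<close> the same join with the complement of \<open>a\<close>.\<close>
    from this[of ?z ?i] have "op a ?z = ?i"
      by (simp add: zero_mem op_mem imp_true)
    then have "op (op a ?z) ?z = ?z" using I0 by simp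
    then show ?thesis using that by (simp add: id)
  qed
  \<comment> \<open>\<open>op (op a a) ?z\<close> is the meet of \<open>a\<close> and its complement.\<close>
  have trichotomy: "a = ?z \<or> a = ?i \<or> op a ?z = a" if a: "a \<in> ?C" for a
  proof (cases "op a a = ?i")
    case True
    have "a = ?i" if "a \<noteq> ?z" 
      by (rule separate[of a]) (use True that a self_imp_neg I0 in \<open>simp_all add: imp_true op_mem\<close>)
    then show ?thesis by blast
  next
    case False
    have "op (op a a) ?z \<noteq> ?z"
      using False nn by metis
    then have "a = op a ?z"
      by (rule separate[rotated 2]) (use a in \<open>simp_all add: neg_imp_self_imp nn op_mem\<close>)
    then show ?thesis by simp
  qed
  have join: "op a b = ?i"
    if "a \<in> ?C" "b \<in> ?C" "op a ?z = a" "op b ?z = b" "a \<noteq> b" "a \<noteq> ?z" for a b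
    using trichotomy[OF op_mem[of a b]] neg_join_zero[of a b] fixed_join_eq[of a b] that by metis
  have unique: "b = c"
    if "a \<in> ?C" "b \<in> ?C" "c \<in> ?C" "op a ?z = a" "op b ?z = b" "op c ?z = c" "a \<noteq> b" "a \<noteq> c" "a \<noteq> ?z"
    for a b c
    by (rule separate[of a]) (use that in \<open>simp_all add: join\<close>)
  have "\<exists>a b. ?C \<subseteq> {?z, ?i, a, b}"
  proof (cases "?C \<subseteq> {?z, ?i}")
    case False
    then obtain a where a: "a \<in> ?C" "a \<noteq> ?z" "a \<noteq> ?i" by auto
    show ?thesis
    proof (cases "?C \<subseteq> {?z, ?i, a}")
      case False
      then obtain b where b: "b \<in> ?C" "b \<notin> {?z, ?i, a}" by auto
      have "c \<in> {?z, ?i, a, b}" if "c \<in> ?C" for c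
        using trichotomy[of c] trichotomy[of a] trichotomy[of b] unique[of a b c] a b that by auto
      then show ?thesis by blast
    qed blast
  qed blast
  then obtain a b where "?C \<subseteq> {?z, ?i, a, b}" by blast
  then have "?C \<subseteq> set [?z, ?i, a, b]" by simp
  from card_mono[OF _ this] finite_subset[OF this] card_length[of "[?z, ?i, a, b]"] show ?thesis
    by simp
qed

lemma simple_involutive:
  assumes simple: "simple A"
  shows "finite (carrier A) \<and> card (carrier A) \<le> 4"
proof (rule simple_kernel_cases[OF simple zroupoid, of "op (zero A)"])
  show "compatible A (op (zero A))"
  proof (rule compatibleI)
    fix x y u w
    assume "x \<in> carrier A" "y \<in> carrier A" "u \<in> carrier A" "w \<in> carrier A"
      "op (zero A) x = op (zero A) y" "op (zero A) u = op (zero A) w"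
    then show "op (zero A) (imp A x u) = op (zero A) (imp A y w)"
      using zero_imp_cong[of x y u w] by (simp add: op_eq)
  qed
next
  assume inj: "inj_on (op (zero A)) (carrier A)"
  have "imp A (zero A) x = x" if "x \<in> carrier A" for x
    using inj_onD[OF inj zero_imp_zero_imp[of x]] that by (simp add: imp_mem op_mem op_eq zero_mem)
  then show ?thesis using simple_fixed[OF simple] by fastforce
next
  assume "\<And>x y. x \<in> carrier A \<Longrightarrow> y \<in> carrier A \<Longrightarrow> op (zero A) x = op (zero A) y"
  then have "imp A (zero A) x = neg A (zero A)" if "x \<in> carrier A" for x
    unfolding neg_def using that zero_mem op_eq[of "zero A"] by metis
  then show ?thesis by (rule simple_de_morgan[OF simple])
qed

end

lemma simple_card_le_4:
  assumes A: "A \<in> implication_zroupoids" and simple: "simple A"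
  shows "finite (carrier A) \<and> card (carrier A) \<le> 4"
proof (cases "\<forall>x\<in>carrier A. \<forall>y\<in>carrier A. imp A x y = zero A")
  case True
  then have "finite (carrier A) \<and> card (carrier A) \<le> 2"
    by (intro simple_null[OF simple implication_zroupoidD(1)[OF A]]) blast
  then show ?thesis by linarith
next
  case False
  interpret zroupoid_algebra A by unfold_locales (rule A)
  note zr = implication_zroupoidD(1)[OF A]
  note mem = zroupoidD[OF zr]
  have zero: "zero A = imp A (neg A (zero A)) (zero A)"
    using implication_zroupoidD(2)[OF A] unfolding neg_def by (rule sym)
  note range = simple_imp_range[OF simple zr zero mem(3)[OF mem(1)] mem(1) False]
  \<comment> \<open>Written as a product whose left factor is again a product, \<open>v\<close> becomes a complement by the defining
    identity.\<close>
  have neg: "\<exists>t\<in>carrier A. v = neg A t" if v: "v \<in> carrier A" for v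
  proof -
    obtain x c where xc: "x \<in> carrier A" "c \<in> carrier A" "v = imp A x c" using range[OF v] .
    obtain a b where ab: "a \<in> carrier A" "b \<in> carrier A" "x = imp A a b" using range[OF xc(1)] .
    have "v = neg A (imp A (imp A (neg A c) a) (neg A (imp A b c)))"
      unfolding xc(3) ab(3) by (rule implication_zroupoidD(3)[OF A ab(1,2) xc(2)])
    with mem ab(1,2) xc(2) show ?thesis by metis
  qed
  have "neg A (neg A v) = v" if v: "v \<in> carrier A" for v
  proof -
    obtain t where t: "t \<in> carrier A" "v = neg A t" using neg[OF v] by blast
    obtain s where s: "s \<in> carrier A" "t = neg A s" using neg[OF t(1)] by blast
    show ?thesis unfolding t s by (rule four_neg_algebra[OF s(1)])
  qed
  then interpret involutive_algebra A by unfold_locales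
  show ?thesis using simple by (rule simple_involutive)
qed


section \<open>Subdirectly irreducible quotients\<close>

lemma congruenceD:
  assumes "congruence A \<theta>"
  shows "equiv (carrier A) \<theta>"
    and "\<lbrakk>(x, y) \<in> \<theta>; (u, w) \<in> \<theta>\<rbrakk> \<Longrightarrow> (imp A x u, imp A y w) \<in> \<theta>"
    and "(x, y) \<in> \<theta> \<Longrightarrow> x \<in> carrier A \<and> y \<in> carrier A"
  using assms unfolding congruence_def equiv_def refl_on_def by blast+

text \<open>
  A quotient must live on the same type as \<open>A\<close> to be a member of the same class of algebras,
  so each block is represented by one of its elements.
\<close>

definition rep :: "('a \<times> 'a) set \<Rightarrow> 'a \<Rightarrow> 'a" where
  "rep \<theta> x = (SOME y. y \<in> \<theta> `` {x})"

definition quotient :: "'a zroupoid \<Rightarrow> ('a \<times> 'a) set \<Rightarrow> 'a zroupoid" where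
  "quotient A \<theta> = \<lparr>carrier = rep \<theta> ` carrier A,
     imp = (\<lambda>x y. rep \<theta> (imp A x y)), zero = rep \<theta> (zero A)\<rparr>"

lemma rep_rel:
  assumes "equiv X \<theta>" "x \<in> X" shows "(x, rep \<theta> x) \<in> \<theta>"
proof -
  have "x \<in> \<theta> `` {x}" using assms by (rule equiv_class_self)
  then have "rep \<theta> x \<in> \<theta> `` {x}" unfolding rep_def by (rule someI)
  then show ?thesis by simp
qed

lemma rep_eq_iff:
  assumes "equiv X \<theta>" "x \<in> X" "y \<in> X" shows "rep \<theta> x = rep \<theta> y \<longleftrightarrow> (x, y) \<in> \<theta>"
proof
  assume "rep \<theta> x = rep \<theta> y"
  with rep_rel[OF assms(1,2)] rep_rel[OF assms(1,3)] assms(1) show "(x, y) \<in> \<theta>"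
    unfolding equiv_def sym_def trans_def by metis
next
  assume "(x, y) \<in> \<theta>"
  then have "\<theta> `` {x} = \<theta> `` {y}" by (rule equiv_class_eq[OF assms(1)])
  then show "rep \<theta> x = rep \<theta> y" by (simp add: rep_def)
qed

lemma quotient_hom:
  assumes A: "zroupoid A" and \<theta>: "congruence A \<theta>"
  shows "rep \<theta> \<in> homs A (quotient A \<theta>)"
proof -
  have "rep \<theta> (imp A x y) = rep \<theta> (imp A (rep \<theta> x) (rep \<theta> y))" if "x \<in> carrier A" "y \<in> carrier A" for x y
  proof -
    have "(imp A x y, imp A (rep \<theta> x) (rep \<theta> y)) \<in> \<theta>"
      using that by (intro congruenceD(2)[OF \<theta>] rep_rel[OF congruenceD(1)[OF \<theta>]])
    then show ?thesis
      using rep_eq_iff[OF congruenceD(1)[OF \<theta>]] congruenceD(3)[OF \<theta>] by blast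
  qed
  then show ?thesis by (simp add: homs_def quotient_def)
qed

lemma models_hom_image:
  assumes A: "A \<in> models E" and h: "h \<in> homs A B" and onto: "h ` carrier A = carrier B"
  shows "B \<in> models E"
proof -
  have zr: "zroupoid A" using A by (simp add: models_def)
  have hom: "h (zero A) = zero B" "\<And>x y. \<lbrakk>x \<in> carrier A; y \<in> carrier A\<rbrakk> \<Longrightarrow> h (imp A x y) = imp B (h x) (h y)"
    using h by (auto simp: homs_def)
  have eval: "eval A v t \<in> carrier A \<and> h (eval A v t) = eval B (h \<circ> v) t" if "range v \<subseteq> carrier A" for v t
    using that by (induction t) (auto simp: hom zroupoidD[OF zr])
  have "zroupoid B"
    unfolding zroupoid_def using zroupoidD[OF zr] by (auto simp flip: onto hom)
  moreover have "eval B w s = eval B w t" if "(s, t) \<in> E" "range w \<subseteq> carrier B" for s t w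
  proof -
    define v where "v = inv_into (carrier A) h \<circ> w"
    have "w n \<in> h ` carrier A" for n
      using that(2) onto by auto
    then have v: "range v \<subseteq> carrier A" "h \<circ> v = w"
      by (auto simp: v_def fun_eq_iff f_inv_into_f inv_into_into)
    have "eval A v s = eval A v t"
      using A that(1) v(1) unfolding models_def by blast
    then show ?thesis
      using eval[OF v(1), of s] eval[OF v(1), of t] v(2) by simp
  qed
  ultimately show ?thesis unfolding models_def by blast
qed

lemma congruence_Union_chain:
  assumes chain: "subset.chain {\<theta>. congruence A \<theta> \<and> P \<theta>} \<C>" and ne: "\<C> \<noteq> {}"
  shows "congruence A (\<Union>\<C>)"
proof -
  have C: "congruence A \<theta>" if "\<theta> \<in> \<C>" for \<theta>
    using chain that by (auto simp: subset.chain_def)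
  have two: "\<exists>\<theta>\<in>\<C>. p \<in> \<theta> \<and> q \<in> \<theta>" if "p \<in> \<Union>\<C>" "q \<in> \<Union>\<C>" for p q
  proof -
    from that obtain \<theta> \<phi> where *: "\<theta> \<in> \<C>" "p \<in> \<theta>" "\<phi> \<in> \<C>" "q \<in> \<phi>" by blast
    with chain have "\<theta> \<subseteq> \<phi> \<or> \<phi> \<subseteq> \<theta>" by (simp add: subset_chain_def)
    with * show ?thesis by blast
  qed
  have eq: "refl_on (carrier A) \<theta>" "sym \<theta>" "trans \<theta>" "\<theta> \<subseteq> carrier A \<times> carrier A" if "\<theta> \<in> \<C>" for \<theta>
    using congruenceD(1,3)[OF C[OF that]] unfolding equiv_def by auto
  have "equiv (carrier A) (\<Union>\<C>)"
  proof (rule equivI)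
    show "\<Union>\<C> \<subseteq> carrier A \<times> carrier A" using eq(4) by blast
    show "refl_on (carrier A) (\<Union>\<C>)" using eq(1) ne unfolding refl_on_def by blast
    show "sym (\<Union>\<C>)" using eq(2) unfolding sym_def by blast
    show "trans (\<Union>\<C>)"
    proof (rule transI)
      fix x y z assume "(x, y) \<in> \<Union>\<C>" "(y, z) \<in> \<Union>\<C>"
      from two[OF this] obtain \<theta> where \<theta>: "\<theta> \<in> \<C>" "(x, y) \<in> \<theta>" "(y, z) \<in> \<theta>" by blast
      with transD[OF eq(3)[OF \<theta>(1)]] show "(x, z) \<in> \<Union>\<C>" by blast
    qed
  qed
  moreover have "(imp A x u, imp A y w) \<in> \<Union>\<C>" if xy: "(x, y) \<in> \<Union>\<C>" and uw: "(u, w) \<in> \<Union>\<C>" for x y u w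
  proof -
    from two[OF xy uw] obtain \<theta> where \<theta>: "\<theta> \<in> \<C>" "(x, y) \<in> \<theta>" "(u, w) \<in> \<theta>" by blast
    with congruenceD(2)[OF C[OF \<theta>(1)]] show ?thesis by blast
  qed
  ultimately show ?thesis unfolding congruence_def by blast
qed

lemma maximal_congruence_omitting:
  assumes A: "zroupoid A" and ab: "a \<noteq> b"
  obtains \<theta> where "congruence A \<theta>" "(a, b) \<notin> \<theta>"
    "\<And>\<phi>. \<lbrakk>congruence A \<phi>; \<theta> \<subseteq> \<phi>; (a, b) \<notin> \<phi>\<rbrakk> \<Longrightarrow> \<phi> = \<theta>"
proof -
  let ?S = "{\<theta>. congruence A \<theta> \<and> (a, b) \<notin> \<theta>}"
  have "congruence A (Id_on (carrier A))"
    using zroupoidD(2)[OF A] unfolding congruence_def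
    by (auto intro!: equivI simp: refl_on_def sym_def trans_def)
  then have "?S \<noteq> {}" using ab by blast
  then have "\<exists>M\<in>?S. \<forall>X\<in>?S. M \<subseteq> X \<longrightarrow> X = M"
  proof (rule subset_Zorn_nonempty)
    fix \<C> assume ne: "\<C> \<noteq> {}" and chain: "subset.chain ?S \<C>"
    have "(a, b) \<notin> \<Union>\<C>" using chain by (auto simp: subset.chain_def)
    with congruence_Union_chain[OF chain ne] show "\<Union>\<C> \<in> ?S" by blast
  qed
  then show thesis using that by blast
qed

text \<open>
  In a subdirect representation of the quotient some coordinate separates the images of \<open>a\<close>
  and \<open>b\<close>. The kernel of that coordinate, pulled back to \<open>A\<close>, contains
  \<open>\<theta>\<close> and omits \<open>(a, b)\<close>, hence equals \<open>\<theta>\<close> by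
  maximality; so the coordinate is injective.
\<close>

lemma quotient_subdirectly_irreducible:
  assumes A: "zroupoid A" and ab: "a \<in> carrier A" "b \<in> carrier A"
    and \<theta>: "congruence A \<theta>" "(a, b) \<notin> \<theta>"
    and max: "\<And>\<phi>. \<lbrakk>congruence A \<phi>; \<theta> \<subseteq> \<phi>; (a, b) \<notin> \<phi>\<rbrakk> \<Longrightarrow> \<phi> = \<theta>"
  shows "subdirectly_irreducible (quotient A \<theta>)"
  unfolding subdirectly_irreducible_def
proof (intro allI impI, elim conjE)
  fix I :: "('a \<times> 'a) set set" and B :: "('a \<times> 'a) set \<Rightarrow> 'a zroupoid" and h
  assume emb: "subdirect_embedding (quotient A \<theta>) I B h"
  let ?q = "rep \<theta>"
  have Q: "carrier (quotient A \<theta>) = ?q ` carrier A" by (simp add: quotient_def)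
  note eq = rep_eq_iff[OF congruenceD(1)[OF \<theta>(1)]]
  have hom: "h \<in> homs (quotient A \<theta>) (product I B)" and inj: "inj_on h (?q ` carrier A)"
    and onto: "\<And>i. i \<in> I \<Longrightarrow> (\<lambda>x. h x i) ` (?q ` carrier A) = carrier (B i)"
    using emb unfolding subdirect_embedding_def Q by blast+
  have qhom: "?q (imp A x u) = imp (quotient A \<theta>) (?q x) (?q u)" if "x \<in> carrier A" "u \<in> carrier A" for x u
    using quotient_hom[OF A \<theta>(1)] that by (simp add: homs_def)
  have imp: "h (?q (imp A x u)) i = imp (B i) (h (?q x) i) (h (?q u) i)"
    if "i \<in> I" "x \<in> carrier A" "u \<in> carrier A" for i x u
    using hom that qhom[OF that(2,3)] by (simp add: homs_def product_def Q)
  have ext: "h (?q x) \<in> extensional I" if "x \<in> carrier A" for x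
    using hom that unfolding homs_def product_def Q by (auto simp: PiE_def Pi_def)
  have "\<exists>i\<in>I. h (?q a) i \<noteq> h (?q b) i"
  proof (rule ccontr)
    assume "\<not> ?thesis"
    then have "h (?q a) = h (?q b)"
      by (intro extensionalityI[OF ext[OF ab(1)] ext[OF ab(2)]]) blast
    then have "?q a = ?q b" using inj ab by (auto dest: inj_onD)
    then show False using eq[OF ab] \<theta>(2) by simp
  qed
  then obtain i where i: "i \<in> I" "h (?q a) i \<noteq> h (?q b) i" by blast
  define \<phi> where "\<phi> = {(x, y). x \<in> carrier A \<and> y \<in> carrier A \<and> h (?q x) i = h (?q y) i}"
  have "congruence A \<phi>"
    unfolding \<phi>_def by (rule congruence_kernel[OF A]) (simp add: compatible_def imp[OF i(1)])
  moreover have "\<theta> \<subseteq> \<phi>"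
    using congruenceD(3)[OF \<theta>(1)] eq unfolding \<phi>_def by fastforce
  moreover have "(a, b) \<notin> \<phi>" using i by (simp add: \<phi>_def)
  ultimately have \<phi>: "\<phi> = \<theta>" by (rule max)
  have "inj_on (\<lambda>x. h x i) (?q ` carrier A)"
  proof (rule inj_onI, elim imageE, hypsubst)
    fix x y assume xy: "x \<in> carrier A" "y \<in> carrier A" "h (?q x) i = h (?q y) i"
    then have "(x, y) \<in> \<phi>" by (simp add: \<phi>_def)
    then show "?q x = ?q y" unfolding \<phi> using eq[OF xy(1,2)] by simp
  qed
  with onto[OF i(1)] i(1)
  show "\<exists>i\<in>I. bij_betw (\<lambda>x. h x i) (carrier (quotient A \<theta>)) (carrier (B i))"
    unfolding bij_betw_def Q by blast
qed


section \<open>Finitely generated algebras with small separating quotients\<close>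

text \<open>
  After renaming its values, a separating map takes values in \<open>{..<N}\<close> and turns the
  operation into a table on \<open>{..<N}\<close>. The table, the image of \<open>zero A\<close> and the
  images of the generators determine the map, by induction on generated elements, so these maps form a
  finite set \<open>D\<close>, and evaluation embeds \<open>A\<close> into the finite set of functions
  from \<open>D\<close> to \<open>{..<N}\<close>.
\<close>

lemma finite_if_separated:
  fixes A :: "'a zroupoid"
  assumes A: "zroupoid A" and G: "finite G" "generated A G = carrier A"
    and sep: "\<And>a b. \<lbrakk>a \<in> carrier A; b \<in> carrier A; a \<noteq> b\<rbrakk> \<Longrightarrow>
      \<exists>f :: 'a \<Rightarrow> 'b. compatible A f \<and> finite (f ` carrier A) \<and> card (f ` carrier A) \<le> N \<and> f a \<noteq> f b"
  shows "finite (carrier A)"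
proof -
  let ?C = "carrier A"
  note mem = zroupoidD[OF A]
  define table where "table p h \<longleftrightarrow> (\<forall>x\<in>?C. \<forall>y\<in>?C. h (imp A x y) = p (h x, h y))"
    for p :: "nat \<times> nat \<Rightarrow> nat" and h :: "'a \<Rightarrow> nat"
  define P where "P = ({..<N} \<times> {..<N}) \<rightarrow>\<^sub>E {..<N}"
  define D where "D = {h \<in> ?C \<rightarrow>\<^sub>E {..<N}. \<exists>p\<in>P. table p h}"
  define pick where "pick h = (SOME p. p \<in> P \<and> table p h)" for h
  have pick: "pick h \<in> P" "table (pick h) h" if "h \<in> D" for h
  proof -
    have "\<exists>p. p \<in> P \<and> table p h" using that by (auto simp: D_def)
    from someI_ex[OF this] show "pick h \<in> P" "table (pick h) h" by (simp_all add: pick_def)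
  qed
  have GC: "G \<subseteq> ?C" using G(2) generated.base[of _ G A] by blast
  have finD: "finite D"
  proof (rule inj_on_finite)
    let ?F = "\<lambda>h. (pick h, h (zero A), restrict h G)"
    show "inj_on ?F D"
    proof (rule inj_onI)
      fix h k assume hk: "h \<in> D" "k \<in> D" "?F h = ?F k"
      have "h x = k x" if "x \<in> generated A G" for x
        using that
      proof induction
        case (base x)
        then show ?case using hk(3) by (metis Pair_inject restrict_apply')
      next
        case zero
        then show ?case using hk(3) by simp
      next
        case (imp x y)
        have "x \<in> ?C" "y \<in> ?C" using imp.hyps G(2) by simp_all
        then have "h (imp A x y) = pick h (h x, h y)" "k (imp A x y) = pick k (k x, k y)"
          using pick(2)[OF hk(1)] pick(2)[OF hk(2)] by (simp_all add: table_def)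
        then show ?case using imp.IH hk(3) by simp
      qed
      moreover have "h \<in> extensional ?C" "k \<in> extensional ?C" using hk by (auto simp: D_def PiE_def)
      ultimately show "h = k" using G(2) by (intro extensionalityI[of h ?C k]) auto
    qed
    show "?F ` D \<subseteq> P \<times> {..<N} \<times> (G \<rightarrow>\<^sub>E {..<N})"
    proof (rule image_subsetI)
      fix h assume h: "h \<in> D"
      then have "h x < N" if "x \<in> ?C" for x using that by (auto simp: D_def)
      then show "?F h \<in> P \<times> {..<N} \<times> (G \<rightarrow>\<^sub>E {..<N})"
        using pick(1)[OF h] mem(1) GC by (auto simp: subset_iff)
    qed
    show "finite (P \<times> {..<N} \<times> (G \<rightarrow>\<^sub>E {..<N}))"
      unfolding P_def by (intro finite_cartesian_product finite_PiE) (simp_all add: G(1))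
  qed
  have sepD: "\<exists>h\<in>D. h a \<noteq> h b" if ab: "a \<in> ?C" "b \<in> ?C" "a \<noteq> b" for a b
  proof -
    obtain f :: "'a \<Rightarrow> 'b" where f: "compatible A f" "finite (f ` ?C)" "card (f ` ?C) \<le> N" "f a \<noteq> f b"
      using sep[OF ab] by blast
    have "card (f ` ?C) \<le> card {..<N}" using f(3) by simp
    then obtain g where g: "g ` (f ` ?C) \<subseteq> {..<N}" "inj_on g (f ` ?C)"
      using card_le_inj[OF f(2) finite_lessThan] by blast
    define h where "h = restrict (g \<circ> f) ?C"
    have h_eq: "h x = h y \<longleftrightarrow> f x = f y" if "x \<in> ?C" "y \<in> ?C" for x y
      using that inj_on_eq_iff[OF g(2)] by (simp add: h_def)
    have h_lt: "h x < N" if "x \<in> ?C" for x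
      using that g(1) by (auto simp: h_def)
    define s where "s = inv_into ?C h"
    have s: "s (h x) \<in> ?C" "h (s (h x)) = h x" if "x \<in> ?C" for x
      using that by (simp_all add: s_def inv_into_into f_inv_into_f)
    \<comment> \<open>\<open>s\<close> picks a preimage for every value of \<open>h\<close>; off the image of \<open>h\<close> the table is filled with \<open>0\<close>, which
      is below \<open>N\<close> because the universe is not empty.\<close>
    define p where "p = (\<lambda>(i, j)\<in>{..<N} \<times> {..<N}.
      if i \<in> h ` ?C \<and> j \<in> h ` ?C then h (imp A (s i) (s j)) else 0)"
    have "N > 0" using h_lt[OF mem(1)] by simp
    then have "p \<in> P"
      unfolding P_def p_def by (auto simp: h_lt mem s)
    moreover have "table p h"
      unfolding table_def
    proof (intro ballI)
      fix x y assume xy: "x \<in> ?C" "y \<in> ?C"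
      have "f (imp A x y) = f (imp A (s (h x)) (s (h y)))"
        using xy s h_eq by (intro compatibleD[OF f(1)]) metis+
      then show "h (imp A x y) = p (h x, h y)"
        using xy by (simp add: p_def h_lt h_eq mem s)
    qed
    ultimately have "h \<in> D" using h_lt by (auto simp: D_def h_def)
    with h_eq[OF ab(1,2)] f(4) show ?thesis by blast
  qed
  show ?thesis
  proof (rule inj_on_finite)
    show "inj_on (\<lambda>a. restrict (\<lambda>h. h a) D) ?C"
    proof (rule inj_onI, rule ccontr)
      fix a b assume ab: "a \<in> ?C" "b \<in> ?C" "restrict (\<lambda>h. h a) D = restrict (\<lambda>h. h b) D" "a \<noteq> b"
      obtain h where "h \<in> D" "h a \<noteq> h b" using sepD[OF ab(1,2,4)] by blast
      with fun_cong[OF ab(3), of h] show False by simp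
    qed
    show "(\<lambda>a. restrict (\<lambda>h. h a) D) ` ?C \<subseteq> D \<rightarrow>\<^sub>E {..<N}"
    proof (rule image_subsetI)
      fix a assume "a \<in> ?C"
      then have "h a \<in> {..<N}" if "h \<in> D" for h
        using that unfolding D_def by blast
      then show "restrict (\<lambda>h. h a) D \<in> D \<rightarrow>\<^sub>E {..<N}"
        by (simp add: restrict_PiE_iff)
    qed
    show "finite (D \<rightarrow>\<^sub>E {..<N})"
      by (intro finite_PiE finD) simp
  qed
qed


section \<open>Semisimple varieties\<close>

theorem corollary5p11:
  fixes V :: "'a zroupoid set"
  assumes "subvariety V implication_zroupoids"
    and "semisimple V"
  shows "locally_finite V"
  unfolding locally_finite_def
proof (intro ballI impI)
  fix A assume A: "A \<in> V" and fg: "finitely_generated A"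
  obtain E where V: "V = models E" and sub: "V \<subseteq> implication_zroupoids"
    using assms(1) by (auto simp: subvariety_def variety_def)
  have zr: "zroupoid A" using A sub implication_zroupoidD(1) by blast
  obtain G where G: "finite G" "generated A G = carrier A"
    using fg by (auto simp: finitely_generated_def)
  from zr G show "finite (carrier A)"
  proof (rule finite_if_separated[where N = 4])
    fix a b assume ab: "a \<in> carrier A" "b \<in> carrier A" "a \<noteq> b"
    obtain \<theta> where \<theta>: "congruence A \<theta>" "(a, b) \<notin> \<theta>"
      "\<And>\<phi>. \<lbrakk>congruence A \<phi>; \<theta> \<subseteq> \<phi>; (a, b) \<notin> \<phi>\<rbrakk> \<Longrightarrow> \<phi> = \<theta>"
      using maximal_congruence_omitting[OF zr ab(3)] by blast
    let ?Q = "quotient A \<theta>" and ?q = "rep \<theta>"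
    have Q: "carrier ?Q = ?q ` carrier A" by (simp add: quotient_def)
    have hom: "?q \<in> homs A ?Q" by (rule quotient_hom[OF zr \<theta>(1)])
    have neq: "?q a \<noteq> ?q b"
      using rep_eq_iff[OF congruenceD(1)[OF \<theta>(1)] ab(1,2)] \<theta>(2) by simp
    have QV: "?Q \<in> V"
      using A models_hom_image[OF _ hom Q[symmetric]] unfolding V by blast
    have "nontrivial ?Q" unfolding nontrivial_def Q using ab neq by blast
    moreover have "subdirectly_irreducible ?Q"
      by (rule quotient_subdirectly_irreducible[OF zr ab(1,2) \<theta>])
    ultimately have "simple ?Q" using assms(2) QV by (simp add: semisimple_def)
    then have "finite (?q ` carrier A) \<and> card (?q ` carrier A) \<le> 4"
      using simple_card_le_4[of ?Q] QV sub unfolding Q by blast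
    moreover have "compatible A ?q"
      unfolding compatible_def using hom by (auto simp: homs_def)
    ultimately show "\<exists>f :: 'a \<Rightarrow> 'a. compatible A f \<and> finite (f ` carrier A) \<and> card (f ` carrier A) \<le> 4 \<and> f a \<noteq> f b"
      using neq by blast
  qed
qed

end
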